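(* Let $R$ be a commutative ring with $1$ and $\mathcal{A}$ a set of non-commuting symbols. The map sending a normalized $R$-valued multiple Dedekind symbol $D_{\mathcal{A}}$ based on $\mathcal{A}$ to its associated function $(p,q)\mapsto D_{\mathcal{A}}(p,q)D_{\mathcal{A}}(-q,p)^{-1}$ is a bijection from the set of normalized $R$-valued multiple Dedekind symbols based on $\mathcal{A}$ onto the set of $R$-valued multiple reciprocity functions based on $\mathcal{A}$.
   Context: $\mathcal{A}^{*}$ denotes the set of words in $\mathcal{A}$ (including the empty word $\emptyset$) with concatenation; $R\langle\langle\mathcal{A}\rangle\rangle$ is the ring of formal power series $\sum_{w\in\mathcal{A}^*}c_w w$ ($c_w\in R$) in the non-commuting symbols and $R\langle\langle\mathcal{A}\rangle\rangle^{\times}$ its unit group. Let $U=\{(p,q)\in\mathbb{Z}^2:\gcd(p,q)=1\}$. For a group $G$, a $G$-valued Dedekind symbol is $D:U\to G$ with $D(p,-q)=D(-p,q)$ and $D(p,q)=D(p,p+q)$; a $G$-valued reciprocity function is $F:U\to G$ with $F(p,-q)=F(-p,q)$, $F(p,q)F(-q,p)=1$ and $F(p,p+q)F(p+q,q)=F(p,q)$ for all $(p,q)\in U$. An $R$-valued multiple Dedekind symbol (resp. multiple reciprocity function) based on $\mathcal{A}$ is an $R\langle\langle\mathcal{A}\rangle\rangle^{\times}$-valued Dedekind symbol (resp. reciprocity function) of the form $1+\sum_{\emptyset\neq w\in\mathcal{A}^*}D^{w}(p,q)w$ with $D^w:U\to R$. A multiple Dedekind symbol $D_{\mathcal{A}}$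 is normalized if $D_{\mathcal{A}}(1,1)=1$. *)

theory Defs
  imports "HOL-Algebra.Algebra"
begin

text \<open>
  A series \<open>\<Sum>\<^sub>w c\<^sub>w w\<close> is its coefficient function \<open>w \<mapsto> c\<^sub>w\<close> on \<open>lists A\<close>, taken to be
  extensional (undefined off \<open>lists A\<close>) so that equality of series is equality of functions.
  The coefficient of \<open>w\<close> in a product sums over all factorizations \<open>w = u @ v\<close>.
\<close>

definition nc_power_series :: "('r, 'm) ring_scheme \<Rightarrow> 'a set \<Rightarrow> ('a list \<Rightarrow> 'r) ring" where
  "nc_power_series R A =
    \<lparr> carrier = lists A \<rightarrow>\<^sub>E carrier R,
      monoid.mult = (\<lambda>f g. \<lambda>w\<in>lists A. \<Oplus>\<^bsub>R\<^esub>i\<in>{..length w}. f (take i w) \<otimes>\<^bsub>R\<^esub> g (drop i w)),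
      monoid.one = (\<lambda>w\<in>lists A. if w = [] then \<one>\<^bsub>R\<^esub> else \<zero>\<^bsub>R\<^esub>),
      ring.zero = (\<lambda>w\<in>lists A. \<zero>\<^bsub>R\<^esub>),
      ring.add = (\<lambda>f g. \<lambda>w\<in>lists A. f w \<oplus>\<^bsub>R\<^esub> g w) \<rparr>"

definition coprime_pairs :: "(int \<times> int) set" where
  "coprime_pairs = {(p, q). gcd p q = 1}"

text \<open>Functions on \<open>coprime_pairs\<close> are likewise extensional, so that injectivity is meaningful.\<close>

definition dedekind_symbol :: "('g, 'm) monoid_scheme \<Rightarrow> (int \<times> int \<Rightarrow> 'g) \<Rightarrow> bool" where
  "dedekind_symbol G D \<longleftrightarrow>
    D \<in> coprime_pairs \<rightarrow>\<^sub>E carrier G \<and>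
    (\<forall>(p, q)\<in>coprime_pairs. D (p, - q) = D (- p, q) \<and> D (p, q) = D (p, p + q))"

definition reciprocity_function :: "('g, 'm) monoid_scheme \<Rightarrow> (int \<times> int \<Rightarrow> 'g) \<Rightarrow> bool" where
  "reciprocity_function G F \<longleftrightarrow>
    F \<in> coprime_pairs \<rightarrow>\<^sub>E carrier G \<and>
    (\<forall>(p, q)\<in>coprime_pairs.
      F (p, - q) = F (- p, q) \<and>
      F (p, q) \<otimes>\<^bsub>G\<^esub> F (- q, p) = \<one>\<^bsub>G\<^esub> \<and>
      F (p, p + q) \<otimes>\<^bsub>G\<^esub> F (p + q, q) = F (p, q))"

definition associated_function ::
    "('g, 'm) monoid_scheme \<Rightarrow> (int \<times> int \<Rightarrow> 'g) \<Rightarrow> int \<times> int \<Rightarrow> 'g" where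
  "associated_function G D =
    (\<lambda>(p, q)\<in>coprime_pairs. D (p, q) \<otimes>\<^bsub>G\<^esub> inv\<^bsub>G\<^esub> D (- q, p))"

text \<open>
  The form \<open>1 + \<Sum>\<^bsub>w \<noteq> \<emptyset>\<^esub> D\<^sup>w(p,q) w\<close> says that the coefficient of the empty word is 1;
  the functions \<open>D\<^sup>w\<close> are \<open>\<lambda>x. D x w\<close>.
\<close>

definition multiple_dedekind_symbol ::
    "('r, 'm) ring_scheme \<Rightarrow> 'a set \<Rightarrow> (int \<times> int \<Rightarrow> 'a list \<Rightarrow> 'r) \<Rightarrow> bool" where
  "multiple_dedekind_symbol R A D \<longleftrightarrow>
    dedekind_symbol (units_of (nc_power_series R A)) D \<and>
    (\<forall>x\<in>coprime_pairs. D x [] = \<one>\<^bsub>R\<^esub>)"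

definition multiple_reciprocity_function ::
    "('r, 'm) ring_scheme \<Rightarrow> 'a set \<Rightarrow> (int \<times> int \<Rightarrow> 'a list \<Rightarrow> 'r) \<Rightarrow> bool" where
  "multiple_reciprocity_function R A F \<longleftrightarrow>
    reciprocity_function (units_of (nc_power_series R A)) F \<and>
    (\<forall>x\<in>coprime_pairs. F x [] = \<one>\<^bsub>R\<^esub>)"

definition normalized ::
    "('r, 'm) ring_scheme \<Rightarrow> 'a set \<Rightarrow> (int \<times> int \<Rightarrow> 'a list \<Rightarrow> 'r) \<Rightarrow> bool" where
  "normalized R A D \<longleftrightarrow> D (1, 1) = \<one>\<^bsub>nc_power_series R A\<^esub>"

end

theory Submission
  imports Defs
begin

text \<open>
  A Dedekind symbol depends only on \<open>\<plusminus>(p, q mod p)\<close>, so writing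
  \<open>D(p,q) = F(p,q) D(-q,p)\<close> and running the Euclidean algorithm determines \<open>D\<close> from its
  associated function \<open>F\<close> and the value \<open>D(1,1)\<close>. Conversely, given \<open>F\<close>, the Euclidean algorithm
  defines \<open>D\<close>, and the relation \<open>D(p,q) = F(p,q) D(-q,p)\<close>, which holds by construction for
  \<open>0 \<le> q < p\<close>, spreads to all coprime pairs: of the three instances at \<open>(p,q)\<close>, \<open>(p,p+q)\<close> and
  \<open>(p+q,q)\<close> any two imply the third. This works over every group; it is applied to the group of
  series with constant term 1.
\<close>

section \<open>Dedekind symbols with values in a group\<close>

lemma coprime_pairs_iff: "(p, q) \<in> coprime_pairs \<longleftrightarrow> coprime p q"
  by (simp add: coprime_pairs_def coprime_iff_gcd_eq_1)

lemma dedekind_symbol_closed: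
  "dedekind_symbol G D \<Longrightarrow> coprime p q \<Longrightarrow> D (p, q) \<in> carrier G"
  by (auto simp: dedekind_symbol_def coprime_pairs_iff)

lemma dedekind_symbol_minus_minus:
  assumes "dedekind_symbol G D" "coprime p q"
  shows "D (- p, - q) = D (p, q)"
proof -
  have "(p, - q) \<in> coprime_pairs" using assms by (simp add: coprime_pairs_iff)
  then have "D (p, - (- q)) = D (- p, - q)"
    using assms(1) unfolding dedekind_symbol_def by blast
  then show ?thesis by simp
qed

lemma dedekind_symbol_add:
  assumes "dedekind_symbol G D" "coprime p q"
  shows "D (p, p + q) = D (p, q)"
  using assms by (force simp: dedekind_symbol_def coprime_pairs_iff)

lemma coprime_add_mult_int: "coprime (p::int) (q + k * p) \<longleftrightarrow> coprime p q"
  by (metis coprime_iff_gcd_eq_1 gcd_add_mult add.commute)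

lemma dedekind_symbol_add_mult:
  assumes "dedekind_symbol G D" "coprime p q"
  shows "D (p, q + k * p) = D (p, q)"
proof -
  have nonneg: "D (p, q + int n * p) = D (p, q)" if "coprime p q" for n q
  proof (induction n)
    case (Suc n)
    have "D (p, p + (q + int n * p)) = D (p, q + int n * p)"
      using that by (intro dedekind_symbol_add[OF assms(1)]) (simp add: coprime_add_mult_int)
    then show ?case using Suc by (simp add: algebra_simps)
  qed simp
  show ?thesis
  proof (cases "k \<ge> 0")
    case True
    then show ?thesis using nonneg[OF assms(2), of "nat k"] by simp
  next
    case False
    \<comment> \<open>For negative \<open>k\<close>, starting at \<open>q + k * p\<close> and adding
      \<open>- k\<close> periods leads back to \<open>q\<close>.\<close>
    then show ?thesis
      using nonneg[of "q + k * p" "nat (- k)"] assms(2) by (simp add: coprime_add_mult_int)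
  qed
qed

lemma coprime_mod_int: "coprime (p::int) (q mod p) \<longleftrightarrow> coprime p q"
  by (metis coprime_mod_right_iff mod_by_0 coprime_commute coprime_mod_left_iff)

lemma dedekind_symbol_mod:
  assumes "dedekind_symbol G D" "coprime p q"
  shows "D (p, q mod p) = D (p, q)"
  using dedekind_symbol_add_mult[OF assms, of "- (q div p)"]
  by (simp add: minus_div_mult_eq_mod)

text \<open>All integers are congruent modulo a unit, so periodicity leaves a single value, and the
  simultaneous sign change identifies \<open>p = - 1\<close> with \<open>p = 1\<close>. This is
  where the Euclidean algorithm ends and the normalization enters.\<close>

lemma dedekind_symbol_unit:
  assumes "dedekind_symbol G D" "\<bar>p\<bar> = 1"
  shows "D (p, q) = D (1, 1)"
proof -
  have one: "D (1, q) = D (1, 1)" for q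
    using dedekind_symbol_add_mult[OF assms(1), of 1 1 "q - 1"] by simp
  show ?thesis
  proof (cases "p = 1")
    case False
    then have "p = - 1" using assms(2) by simp
    then show ?thesis
      using one[of "- q"] dedekind_symbol_minus_minus[OF assms(1), of 1 "- q"] by simp
  qed (use one[of q] in simp)
qed

lemma coprime_add_int:
  fixes p q :: int
  assumes "coprime p q"
  shows "coprime p (p + q)" "coprime (p + q) q"
  using assms coprime_add_mult_int[of p q 1] coprime_add_mult_int[of q p 1]
  by (simp_all add: add.commute coprime_commute)

text \<open>The second entries \<open>p\<close> and \<open>- q\<close> differ by the period
  \<open>p + q\<close>. This identity matches the inner terms of the three-term relation.\<close>

lemma dedekind_symbol_minus_add:
  assumes D: "dedekind_symbol G D" and c: "coprime p q"
  shows "D (- (p + q), p) = D (p + q, q)"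
proof -
  have "coprime (- (p + q)) p"
    using coprime_add_int(1)[OF c]
    by (simp only: coprime_minus_left_iff) (simp only: coprime_commute)
  from dedekind_symbol_add[OF D this] have "D (- (p + q), p) = D (- (p + q), - q)"
    by simp
  also have "\<dots> = D (p + q, q)"
    by (rule dedekind_symbol_minus_minus[OF D coprime_add_int(2)[OF c]])
  finally show ?thesis .
qed

lemma reciprocity_function_closed:
  "reciprocity_function G F \<Longrightarrow> coprime p q \<Longrightarrow> F (p, q) \<in> carrier G"
  by (auto simp: reciprocity_function_def coprime_pairs_iff)

lemma reciprocity_function_minus_minus:
  assumes "reciprocity_function G F" "coprime p q"
  shows "F (- p, - q) = F (p, q)"
proof -
  have "(p, - q) \<in> coprime_pairs" using assms by (simp add: coprime_pairs_iff)
  then have "F (p, - (- q)) = F (- p, - q)"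
    using assms(1) unfolding reciprocity_function_def by blast
  then show ?thesis by simp
qed

lemma reciprocity_function_rotate:
  assumes "reciprocity_function G F" "coprime p q"
  shows "F (p, q) \<otimes>\<^bsub>G\<^esub> F (- q, p) = \<one>\<^bsub>G\<^esub>"
  using assms by (auto simp: reciprocity_function_def coprime_pairs_iff)

lemma reciprocity_function_add:
  assumes "reciprocity_function G F" "coprime p q"
  shows "F (p, p + q) \<otimes>\<^bsub>G\<^esub> F (p + q, q) = F (p, q)"
  using assms by (auto simp: reciprocity_function_def coprime_pairs_iff)

section \<open>The associated function and its injectivity on normalized symbols\<close>

context group
begin

lemma associated_function_eq:
  "coprime p q \<Longrightarrow> associated_function G D (p, q) = D (p, q) \<otimes> inv D (- q, p)"
  by (simp add: associated_function_def coprime_pairs_iff)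

lemma mult_inv_mult_cancel:
  assumes "x \<in> carrier G" "y \<in> carrier G" "z \<in> carrier G"
  shows "(x \<otimes> inv y) \<otimes> (y \<otimes> inv z) = x \<otimes> inv z"
  using assms by (metis inv_closed m_assoc m_closed l_inv l_one)

text \<open>Both product relations telescope. In the three-term one, the factor
  \<open>inv D (- (p + q), p)\<close> cancels \<open>D (p + q, q)\<close>, and the outer factors
  reduce to \<open>D (p, q)\<close> and \<open>inv D (- q, p)\<close> by periodicity.\<close>

lemma reciprocity_function_associated_function:
  assumes D: "dedekind_symbol G D"
  shows "reciprocity_function G (associated_function G D)"
proof -
  note closed = dedekind_symbol_closed[OF D]
  let ?F = "associated_function G D"
  have "?F \<in> coprime_pairs \<rightarrow>\<^sub>E carrier G"
    by (auto simp: associated_function_def coprime_pairs_iff coprime_commute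
        intro!: m_closed inv_closed closed)
  moreover have "?F (p, - q) = ?F (- p, q) \<and> ?F (p, q) \<otimes> ?F (- q, p) = \<one> \<and>
      ?F (p, p + q) \<otimes> ?F (p + q, q) = ?F (p, q)" if c: "coprime p q" for p q
  proof (intro conjI)
    have c': "coprime q p" using c by (simp add: coprime_commute)
    have e1: "D (p, - q) = D (- p, q)" "D (q, p) = D (- q, - p)" "D (- p, - q) = D (p, q)"
      using dedekind_symbol_minus_minus[OF D, of "- p" q] dedekind_symbol_minus_minus[OF D, of q p]
        dedekind_symbol_minus_minus[OF D, of p q] c c' by simp_all
    show "?F (p, - q) = ?F (- p, q)"
      using c by (simp add: associated_function_eq e1)
    show "?F (p, q) \<otimes> ?F (- q, p) = \<one>"
      using c c' by (simp add: associated_function_eq e1 closed mult_inv_mult_cancel)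
    have e2: "D (p, p + q) = D (p, q)" by (rule dedekind_symbol_add[OF D c])
    have e3: "D (- q, p + q) = D (- q, p)"
      using dedekind_symbol_add_mult[OF D, of "- q" p "- 1"] c' by simp
    have c2: "coprime (p + q) q" "coprime p (p + q)"
      using coprime_add_int[OF c] by auto
    have e4: "D (- (p + q), p) = D (p + q, q)"
      by (rule dedekind_symbol_minus_add[OF D c])
    show "?F (p, p + q) \<otimes> ?F (p + q, q) = ?F (p, q)"
      using c c' c2 closed[of "p + q" q] closed[of p q] closed[of "- q" p]
      by (simp only: associated_function_eq e2 e3 e4) (simp add: mult_inv_mult_cancel)
  qed
  ultimately show ?thesis
    by (auto simp: reciprocity_function_def coprime_pairs_iff)
qed

lemma dedekind_symbol_eq_associated_function_mult:
  assumes "dedekind_symbol G D" "coprime p q"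
  shows "D (p, q) = associated_function G D (p, q) \<otimes> D (- q, p)"
  using assms dedekind_symbol_closed[OF assms(1), of p q]
    dedekind_symbol_closed[OF assms(1), of "- q" p]
  by (simp add: associated_function_eq m_assoc coprime_commute)

lemma associated_function_inj:
  assumes D: "dedekind_symbol G D" and D': "dedekind_symbol G D'"
    and base: "D (1, 1) = D' (1, 1)"
    and F: "associated_function G D = associated_function G D'"
  shows "D = D'"
proof -
  have "D (p, q) = D' (p, q)" if "coprime p q" for p q
    using that
  proof (induction "nat \<bar>p\<bar>" arbitrary: p q rule: less_induct)
    case less
    show ?case
    \<comment> \<open>Both cases are terminal. Reduction modulo 0 makes no progress, while reducing
      \<open>p\<close> of absolute value 1 leads to 0, whose value is itself computed from a unit by
      one rotation; the common value at (1, 1) breaks this circle.\<close>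
    proof (cases "p = 0 \<or> \<bar>p\<bar> = 1")
      case True
      then show ?thesis
      proof
        assume p: "p = 0"
        then have "\<bar>- q\<bar> = 1" using less.prems by simp
        then show ?thesis
          using dedekind_symbol_unit[OF D, of "- q" p] dedekind_symbol_unit[OF D', of "- q" p] base F
            dedekind_symbol_eq_associated_function_mult[OF D less.prems]
            dedekind_symbol_eq_associated_function_mult[OF D' less.prems]
          by simp
      next
        assume "\<bar>p\<bar> = 1"
        then show ?thesis
          using dedekind_symbol_unit[OF D, of p q] dedekind_symbol_unit[OF D', of p q] base by simp
      qed
    next
      case False
      define r where "r = q mod p"
      have r: "coprime p r" using less.prems by (simp add: r_def coprime_mod_int)
      \<comment> \<open>The remainder is smaller in absolute value for negative \<open>p\<close>
        too, so no sign normalization precedes the descent.\<close>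
      have "nat \<bar>- r\<bar> < nat \<bar>p\<bar>" using False abs_mod_less[of p q] by (simp add: r_def)
      then have "D (- r, p) = D' (- r, p)"
        using r by (intro less.hyps) (auto simp: coprime_commute)
      then have "D (p, r) = D' (p, r)"
        using dedekind_symbol_eq_associated_function_mult[OF D r]
          dedekind_symbol_eq_associated_function_mult[OF D' r] F by simp
      then show ?thesis
        using dedekind_symbol_mod[OF D less.prems] dedekind_symbol_mod[OF D' less.prems]
        by (simp add: r_def)
    qed
  qed
  moreover have "D \<in> extensional coprime_pairs" "D' \<in> extensional coprime_pairs"
    using D D' by (auto simp: dedekind_symbol_def PiE_def)
  ultimately show ?thesis
    by (intro extensionalityI[of D coprime_pairs]) (auto simp: coprime_pairs_iff)
qed

end

text \<open>
  The value at \<open>(n, q)\<close> with \<open>n \<ge> 0\<close> of the normalized symbol with associated function \<open>F\<close>;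
  \<open>(r, - n)\<close> stands for \<open>(- r, n)\<close>.
\<close>

function euclid_symbol :: "('g, 'm) monoid_scheme \<Rightarrow> (int \<times> int \<Rightarrow> 'g) \<Rightarrow> nat \<Rightarrow> int \<Rightarrow> 'g" where
  "euclid_symbol G F n q =
    (if n = 0 then F (0, 1)
     else if n = 1 then \<one>\<^bsub>G\<^esub>
     else F (int n, q mod int n) \<otimes>\<^bsub>G\<^esub> euclid_symbol G F (nat (q mod int n)) (- int n))"
  by pat_completeness auto
termination
  by (relation "measure (\<lambda>(G, F, n, q). n)") (auto simp: nat_less_iff)

declare euclid_symbol.simps [simp del]

text \<open>This value is forced: D(0,1) = F(0,1) D(-1,0), and a normalized symbol takes the value 1
  at (-1,0).\<close>

lemma euclid_symbol_0: "euclid_symbol G F 0 q = F (0, 1)"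
  by (subst euclid_symbol.simps) simp

lemma euclid_symbol_1: "euclid_symbol G F (Suc 0) q = \<one>\<^bsub>G\<^esub>"
  by (subst euclid_symbol.simps) simp

text \<open>The factor \<open>sgn p\<close> moves a pair with negative \<open>p\<close> to its
  opposite, where a symbol has the same value. For \<open>p = 0\<close> it replaces \<open>q\<close>
  by 0, which is harmless since \<open>euclid_symbol\<close> ignores its last argument
  there.\<close>

definition symbol_of_reciprocity ::
    "('g, 'm) monoid_scheme \<Rightarrow> (int \<times> int \<Rightarrow> 'g) \<Rightarrow> int \<times> int \<Rightarrow> 'g" where
  "symbol_of_reciprocity G F =
    (\<lambda>(p, q)\<in>coprime_pairs. euclid_symbol G F (nat \<bar>p\<bar>) (sgn p * q))"

lemma symbol_of_reciprocity_eq: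
  "coprime p q \<Longrightarrow> symbol_of_reciprocity G F (p, q) = euclid_symbol G F (nat \<bar>p\<bar>) (sgn p * q)"
  by (simp add: symbol_of_reciprocity_def coprime_pairs_iff)

lemma euclid_symbol_cong_mod:
  "q mod int n = q' mod int n \<Longrightarrow> euclid_symbol G F n q = euclid_symbol G F n q'"
  by (subst (1 2) euclid_symbol.simps) simp

lemma symbol_of_reciprocity_unit:
  "\<bar>p\<bar> = 1 \<Longrightarrow> symbol_of_reciprocity G F (p, q) = \<one>\<^bsub>G\<^esub>"
  by (subst symbol_of_reciprocity_eq) (auto simp: euclid_symbol_1 abs_if split: if_splits)

section \<open>Surjectivity: verification of the Euclidean construction\<close>

context group
begin

text \<open>The disjunct \<open>n = 0\<close> covers the calls at \<open>p = 0\<close>, where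
  \<open>sgn p * q\<close> is 0 and coprimality fails.\<close>

lemma euclid_symbol_closed:
  assumes F: "reciprocity_function G F"
  shows "n = 0 \<or> coprime (int n) q \<Longrightarrow> euclid_symbol G F n q \<in> carrier G"
proof (induction n arbitrary: q rule: less_induct)
  case (less n)
  show ?case
  proof (cases "n = 0 \<or> n = 1")
    case True
    then show ?thesis
      using reciprocity_function_closed[OF F, of 0 1] by (auto simp: euclid_symbol_0 euclid_symbol_1)
  next
    case False
    define r where "r = q mod int n"
    have r: "0 \<le> r" "r < int n" "coprime (int n) r"
      using False less.prems by (auto simp: r_def coprime_mod_int)
    have "euclid_symbol G F (nat r) (- int n) \<in> carrier G"
      using r by (intro less.IH) (auto simp: coprime_commute)
    then show ?thesis
      using False reciprocity_function_closed[OF F r(3)]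
      by (subst euclid_symbol.simps) (simp add: r_def)
  qed
qed

lemma dedekind_symbol_symbol_of_reciprocity:
  assumes F: "reciprocity_function G F"
  shows "dedekind_symbol G (symbol_of_reciprocity G F)"
proof -
  let ?D = "symbol_of_reciprocity G F"
  have cop: "nat \<bar>p\<bar> = 0 \<or> coprime (int (nat \<bar>p\<bar>)) (sgn p * q)" if "coprime p q" for p q
    using that by (auto simp: sgn_if)
  have "?D \<in> coprime_pairs \<rightarrow>\<^sub>E carrier G"
    using euclid_symbol_closed[OF F] cop
    by (auto simp: symbol_of_reciprocity_def coprime_pairs_iff)
  moreover have "?D (p, - q) = ?D (- p, q)" if "coprime p q" for p q
    using that by (simp add: symbol_of_reciprocity_eq)
  moreover have "?D (p, q) = ?D (p, p + q)" if c: "coprime p q" for p q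
  proof -
    have "(sgn p * q) mod \<bar>p\<bar> = (sgn p * (p + q)) mod \<bar>p\<bar>"
      by (auto simp: sgn_if)
    then show ?thesis
      unfolding symbol_of_reciprocity_eq[OF c] symbol_of_reciprocity_eq[OF coprime_add_int(1)[OF c]]
      by (intro euclid_symbol_cong_mod) simp
  qed
  ultimately show ?thesis
    by (auto simp: dedekind_symbol_def coprime_pairs_iff)
qed

text \<open>The relation, called \<open>E\<close>, is first read off the recursion for 0 < q < p,
  then carried to the positive quadrant by the subtractive Euclidean algorithm, and finally to all
  pairs by quarter turns and the simultaneous sign change.\<close>

lemma symbol_of_reciprocity_reciprocity:
  assumes F: "reciprocity_function G F" and "coprime p q"
  shows "symbol_of_reciprocity G F (p, q) = F (p, q) \<otimes> symbol_of_reciprocity G F (- q, p)"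
proof -
  define D where "D = symbol_of_reciprocity G F"
  define E where "E p q \<longleftrightarrow> D (p, q) = F (p, q) \<otimes> D (- q, p)" for p q
  have D: "dedekind_symbol G D"
    unfolding D_def by (rule dedekind_symbol_symbol_of_reciprocity[OF F])
  note Dcl = dedekind_symbol_closed[OF D] and Fcl = reciprocity_function_closed[OF F]
  note Dmm = dedekind_symbol_minus_minus[OF D] and Fmm = reciprocity_function_minus_minus[OF F]

  have E_minus: "E (- p) (- q) \<longleftrightarrow> E p q" if "coprime p q" for p q
    using that Dmm[of p q] Dmm[of "- q" p] Fmm[of p q] by (simp add: E_def coprime_commute)
  \<comment> \<open>Two quarter turns give the opposite pair, where \<open>D\<close> has the same
    value, and the two factors of \<open>F\<close> cancel.\<close>
  have E_rotate: "E p q" if c: "coprime p q" and E: "E (- q) p" for p q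
  proof -
    have c': "coprime q p" using c by (simp add: coprime_commute)
    have "F (p, q) \<otimes> D (- q, p) = (F (p, q) \<otimes> F (- q, p)) \<otimes> D (- p, - q)"
      using E c c' by (simp add: E_def m_assoc Fcl Dcl)
    then show ?thesis
      using c reciprocity_function_rotate[OF F c] Dmm[OF c] by (simp add: E_def Dcl)
  qed
  have E_add: "E p (p + q)" if c: "coprime p q" and E1: "E p q" and E2: "E (p + q) q" for p q
  proof -
    have c': "coprime q p" using c by (simp add: coprime_commute)
    note c2 = coprime_add_int[OF c]
    have e1: "D (- (p + q), p) = D (p + q, q)"
      by (rule dedekind_symbol_minus_add[OF D c])
    have e2: "D (- q, p + q) = D (- q, p)"
      using dedekind_symbol_add_mult[OF D, of "- q" p "- 1"] c' by simp
    have "F (p, p + q) \<otimes> D (- (p + q), p) = F (p, p + q) \<otimes> (F (p + q, q) \<otimes> D (- q, p))"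
      using E2 by (simp only: E_def e1 e2)
    also have "\<dots> = (F (p, p + q) \<otimes> F (p + q, q)) \<otimes> D (- q, p)"
      using c c' c2 by (intro m_assoc[symmetric]) (auto intro: Fcl Dcl)
    also have "\<dots> = F (p, q) \<otimes> D (- q, p)"
      by (simp only: reciprocity_function_add[OF F c])
    also have "\<dots> = D (p, p + q)"
      using E1 dedekind_symbol_add[OF D c] by (simp add: E_def)
    finally show ?thesis by (simp add: E_def)
  qed
  \<comment> \<open>Here \<open>p\<close> is at least 2 and \<open>q mod p = q\<close>, so the
    relation is one unfolding of the recursion; its inner call at \<open>q\<close> and
    \<open>- p\<close> encodes the pair \<open>(- q, p)\<close>.\<close>
  have E_base: "E p q" if "0 < q" "q < p" "coprime p q" for p q
  proof -
    have c': "coprime (- q) p" using that(3) by (simp add: coprime_commute)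
    have "D (p, q) = euclid_symbol G F (nat p) q"
      using that by (simp add: D_def symbol_of_reciprocity_eq)
    also have "\<dots> = F (p, q) \<otimes> euclid_symbol G F (nat q) (- p)"
      using that by (subst euclid_symbol.simps) (simp add: nat_eq_iff)
    also have "euclid_symbol G F (nat q) (- p) = D (- q, p)"
      using that by (simp add: D_def symbol_of_reciprocity_eq[OF c'])
    finally show ?thesis by (simp add: E_def)
  qed
  have E_pos: "E p q" if "0 < p" "0 < q" "coprime p q" for p q
    using that
  proof (induction "nat (p + q)" arbitrary: p q rule: less_induct)
    case less
    consider "q < p" | "p < q" | "p = q" by linarith
    then show ?case
    proof cases
      case 1
      then show ?thesis using less.prems by (intro E_base)
    next
      case 2
      \<comment> \<open>In the three-term relation for \<open>(p, q - p)\<close>, that pair has a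
        smaller sum, and the other known instance \<open>(q, q - p)\<close> satisfies 0 < q - p <
        q.\<close>
      have c: "coprime p (q - p)"
        using coprime_add_mult_int[of p q "- 1"] less.prems by simp
      have "E p (q - p)" using 2 less.prems c by (intro less.hyps) auto
      moreover have "E q (q - p)"
        using 2 less.prems coprime_add_int(2)[OF c] by (intro E_base) auto
      ultimately show ?thesis using E_add[OF c] by simp
    next
      case 3
      then have "p = 1" "q = 1" using less.prems by auto
      \<comment> \<open>Cancelling \<open>F (1, 0)\<close> in the three-term relation at (1, 0)
        forces \<open>F (1, 1)\<close> to be 1, in accordance with the normalization.\<close>
      have "F (1, 1) \<otimes> F (1, 0) = F (1, 0)"
        using reciprocity_function_add[OF F, of 1 0] by simp
      then have "F (1, 1) = \<one>"
        using Fcl[of 1 1] Fcl[of 1 0] by simp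
      then show ?thesis
        using \<open>p = 1\<close> \<open>q = 1\<close> by (simp add: E_def D_def symbol_of_reciprocity_unit)
    qed
  qed
  have E_zero: "E 0 q" if "\<bar>q\<bar> = 1" for q
  proof -
    have "F (0, q) = F (0, 1)"
      using that Fmm[of 0 1] by (cases "q = 1") (auto simp: abs_if split: if_splits)
    moreover have "D (0, q) = F (0, 1)"
      using that by (simp add: D_def symbol_of_reciprocity_eq euclid_symbol_0)
    ultimately show ?thesis
      using that Fcl[of 0 1] by (simp add: E_def D_def symbol_of_reciprocity_unit)
  qed
  have E_nonneg: "E p q" if "0 \<le> p" "coprime p q" for p q
  proof -
    have c': "coprime (- q) p" using that by (simp add: coprime_commute)
    \<comment> \<open>A quarter turn sends the half-axis \<open>q = 0\<close> to
      \<open>p = 0\<close> and the fourth quadrant to the first.\<close>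
    consider "p = 0" | "q = 0" | "0 < p" "0 < q" | "0 < p" "q < 0" using \<open>0 \<le> p\<close> by linarith
    then show ?thesis
    proof cases
      case 1
      then show ?thesis using that by (auto intro: E_zero)
    next
      case 2
      then show ?thesis using that E_rotate[OF that(2)] E_zero[of p] by simp
    next
      case 3
      then show ?thesis using that by (intro E_pos)
    next
      case 4
      then show ?thesis using c' E_rotate[OF that(2)] E_pos[of "- q" p] by simp
    qed
  qed
  have "E p q"
    using E_nonneg[of p q] E_nonneg[of "- p" "- q"] E_minus[of p q] assms(2) by (cases "0 \<le> p") auto
  then show ?thesis by (simp add: E_def D_def)
qed

lemma associated_function_symbol_of_reciprocity:
  assumes F: "reciprocity_function G F"
  shows "associated_function G (symbol_of_reciprocity G F) = F"
proof -
  let ?D = "symbol_of_reciprocity G F"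
  have "associated_function G ?D (p, q) = F (p, q)" if c: "coprime p q" for p q
  proof -
    have "?D (- q, p) \<in> carrier G" "F (p, q) \<in> carrier G"
      using c dedekind_symbol_closed[OF dedekind_symbol_symbol_of_reciprocity[OF F]]
        reciprocity_function_closed[OF F]
      by (simp_all add: coprime_commute)
    then show ?thesis
      using symbol_of_reciprocity_reciprocity[OF F c] c
      by (simp add: associated_function_eq m_assoc)
  qed
  moreover have "associated_function G ?D \<in> extensional coprime_pairs"
    "F \<in> extensional coprime_pairs"
    using F by (auto simp: associated_function_def reciprocity_function_def PiE_def)
  ultimately show ?thesis
    by (intro extensionalityI[of _ coprime_pairs]) (auto simp: coprime_pairs_iff)
qed

theorem bij_betw_associated_function:
  "bij_betw (associated_function G) {D. dedekind_symbol G D \<and> D (1, 1) = \<one>}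
     {F. reciprocity_function G F}"
  unfolding bij_betw_def
proof
  show "inj_on (associated_function G) {D. dedekind_symbol G D \<and> D (1, 1) = \<one>}"
    by (rule inj_onI) (auto intro: associated_function_inj)
  have "F \<in> associated_function G ` {D. dedekind_symbol G D \<and> D (1, 1) = \<one>}"
    if "reciprocity_function G F" for F
    using associated_function_symbol_of_reciprocity[OF that, symmetric]
      dedekind_symbol_symbol_of_reciprocity[OF that]
    by (intro image_eqI) (auto simp: symbol_of_reciprocity_unit)
  then show "associated_function G ` {D. dedekind_symbol G D \<and> D (1, 1) = \<one>} =
      {F. reciprocity_function G F}"
    using reciprocity_function_associated_function by blast
qed

end

section \<open>The group of noncommutative power series with constant term 1\<close>

text \<open>
  The product of \<open>nc_power_series\<close>, computed by recursion on the word so that associativity follows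
  by induction from linearity in the first factor, without exchanging double sums.
\<close>

fun (in ring) word_conv :: "('w list \<Rightarrow> 'a) \<Rightarrow> ('w list \<Rightarrow> 'a) \<Rightarrow> 'w list \<Rightarrow> 'a" where
  "word_conv f g [] = f [] \<otimes> g []"
| "word_conv f g (x # w) = f [] \<otimes> g (x # w) \<oplus> word_conv (\<lambda>u. f (x # u)) g w"

lemma Pi_lists_Cons:
  "f \<in> lists A \<rightarrow> C \<Longrightarrow> x \<in> A \<Longrightarrow> (\<lambda>u. f (x # u)) \<in> lists A \<rightarrow> C"
  by (auto simp: Pi_iff)

section \<open>Convolution of coefficient functions on words\<close>

context ring
begin

lemma word_conv_closed:
  assumes "g \<in> lists A \<rightarrow> carrier R"
  shows "f \<in> lists A \<rightarrow> carrier R \<Longrightarrow> w \<in> lists A \<Longrightarrow> word_conv f g w \<in> carrier R"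
proof (induction w arbitrary: f)
  case (Cons x w)
  then have "word_conv (\<lambda>u. f (x # u)) g w \<in> carrier R"
    by (intro Cons.IH Pi_lists_Cons) auto
  then show ?case using Cons.prems assms by (auto simp: Pi_iff)
qed (use assms in \<open>auto simp: Pi_iff\<close>)

lemma finsum_eq_word_conv:
  assumes "g \<in> lists A \<rightarrow> carrier R"
  shows "f \<in> lists A \<rightarrow> carrier R \<Longrightarrow> w \<in> lists A \<Longrightarrow>
    (\<Oplus>i\<in>{..length w}. f (take i w) \<otimes> g (drop i w)) = word_conv f g w"
proof (induction w arbitrary: f)
  case (Cons x w)
  have mem: "take i u \<in> lists A" "drop i u \<in> lists A" if "u \<in> lists A" for i u
    using that by (auto dest: in_set_takeD in_set_dropD)
  \<comment> \<open>The index 0, the empty prefix, is split off; every other prefix begins with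
    \<open>x\<close>, and shifting the index leaves a convolution over \<open>w\<close>.\<close>
  have "(\<Oplus>i\<in>{..length (x # w)}. f (take i (x # w)) \<otimes> g (drop i (x # w))) =
      (\<Oplus>i\<in>{..length w}. f (x # take i w) \<otimes> g (drop i w)) \<oplus> f [] \<otimes> g (x # w)"
    using Cons.prems assms mem[OF Cons.prems(2)] by (simp, subst finsum_Suc2) (auto simp: Pi_iff)
  also have "(\<Oplus>i\<in>{..length w}. f (x # take i w) \<otimes> g (drop i w)) = word_conv (\<lambda>u. f (x # u)) g w"
    using Cons.prems by (intro Cons.IH Pi_lists_Cons) auto
  also have "word_conv (\<lambda>u. f (x # u)) g w \<oplus> f [] \<otimes> g (x # w) = word_conv f g (x # w)"
    using Cons.prems word_conv_closed[OF assms Pi_lists_Cons[OF Cons.prems(1)], of x w]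
      funcset_mem[OF Cons.prems(1), of "[]"] funcset_mem[OF assms, of "x # w"]
    by (simp add: a_comm)
  finally show ?case .
qed (use assms in \<open>auto simp: Pi_iff\<close>)

text \<open>A convolution at a word over \<open>A\<close> reads its arguments only at words over
  \<open>A\<close>. This removes the inner \<open>restrict\<close> from iterated products of
  series.\<close>

lemma word_conv_cong:
  assumes "\<And>u. u \<in> lists A \<Longrightarrow> g u = g' u"
  shows "(\<And>u. u \<in> lists A \<Longrightarrow> f u = f' u) \<Longrightarrow> w \<in> lists A \<Longrightarrow> word_conv f g w = word_conv f' g' w"
proof (induction w arbitrary: f f')
  case (Cons x w)
  then have "word_conv (\<lambda>u. f (x # u)) g w = word_conv (\<lambda>u. f' (x # u)) g' w"
    by (intro Cons.IH) auto
  then show ?case using Cons.prems assms by auto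
qed (use assms in auto)

text \<open>The combination has the shape produced by deleting a leading letter \<open>x\<close>
  from a product: the coefficients at \<open>x # u\<close> are \<open>f []\<close> times those of
  the shifted second factor plus the product with the shifted first factor. Associativity needs
  exactly this case.\<close>

lemma word_conv_linear_left:
  assumes "a \<in> carrier R" and h: "h \<in> lists A \<rightarrow> carrier R"
  shows "f \<in> lists A \<rightarrow> carrier R \<Longrightarrow> g \<in> lists A \<rightarrow> carrier R \<Longrightarrow> w \<in> lists A \<Longrightarrow>
    word_conv (\<lambda>u. a \<otimes> f u \<oplus> g u) h w = a \<otimes> word_conv f h w \<oplus> word_conv g h w"
proof (induction w arbitrary: f g)
  case Nil
  then have "f [] \<in> carrier R" "g [] \<in> carrier R" "h [] \<in> carrier R"
    using h by auto
  then show ?case using assms(1) by (simp add: l_distr m_assoc)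
next
  case (Cons x w)
  let ?f = "\<lambda>u. f (x # u)" and ?g = "\<lambda>u. g (x # u)"
  have fg: "?f \<in> lists A \<rightarrow> carrier R" "?g \<in> lists A \<rightarrow> carrier R" and w: "w \<in> lists A"
    using Pi_lists_Cons[OF Cons.prems(1)] Pi_lists_Cons[OF Cons.prems(2)] Cons.prems(3) by auto
  have cl: "f [] \<in> carrier R" "g [] \<in> carrier R" "h (x # w) \<in> carrier R"
    "word_conv ?f h w \<in> carrier R" "word_conv ?g h w \<in> carrier R"
    using Cons.prems fg w by (auto intro!: word_conv_closed[OF h] funcset_mem[OF h])
  show ?case
    using cl assms(1) by (simp add: Cons.IH[OF fg w] l_distr r_distr m_assoc a_ac)
qed

lemma word_conv_assoc:
  assumes g: "g \<in> lists A \<rightarrow> carrier R" and h: "h \<in> lists A \<rightarrow> carrier R"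
  shows "f \<in> lists A \<rightarrow> carrier R \<Longrightarrow> w \<in> lists A \<Longrightarrow>
    word_conv (word_conv f g) h w = word_conv f (word_conv g h) w"
proof (induction w arbitrary: f)
  case Nil
  then have "f [] \<in> carrier R" "g [] \<in> carrier R" "h [] \<in> carrier R"
    using g h by auto
  then show ?case by (simp add: m_assoc)
next
  case (Cons x w)
  let ?f = "\<lambda>u. f (x # u)" and ?g = "\<lambda>u. g (x # u)"
  have fg: "?f \<in> lists A \<rightarrow> carrier R" "?g \<in> lists A \<rightarrow> carrier R" and w: "w \<in> lists A"
    using Pi_lists_Cons[OF Cons.prems(1)] Pi_lists_Cons[OF g] Cons.prems(2) by auto
  have fgc: "word_conv ?f g \<in> lists A \<rightarrow> carrier R"
    using fg g by (auto intro!: word_conv_closed)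
  have f0: "f [] \<in> carrier R" using Cons.prems by auto
  have cl: "g [] \<in> carrier R" "h (x # w) \<in> carrier R"
    "word_conv ?g h w \<in> carrier R" "word_conv (word_conv ?f g) h w \<in> carrier R"
    using Cons.prems g fg fgc w by (auto intro!: word_conv_closed[OF h] funcset_mem[OF h])
  have "word_conv (word_conv f g) h (x # w) = f [] \<otimes> g [] \<otimes> h (x # w) \<oplus>
      (f [] \<otimes> word_conv ?g h w \<oplus> word_conv (word_conv ?f g) h w)"
    by (simp add: word_conv_linear_left[OF f0 h fg(2) fgc w])
  also have "\<dots> = f [] \<otimes> word_conv g h (x # w) \<oplus> word_conv (word_conv ?f g) h w"
    using f0 cl by (simp add: r_distr m_assoc a_assoc)
  also have "\<dots> = word_conv f (word_conv g h) (x # w)"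
    by (simp add: Cons.IH[OF fg(1) w])
  finally show ?case .
qed

lemma word_conv_zero_left:
  assumes "g \<in> lists A \<rightarrow> carrier R" "w \<in> lists A"
  shows "word_conv (\<lambda>_. \<zero>) g w = \<zero>"
  using assms(2,1) by (induction w) (auto simp: Pi_iff)

lemma word_conv_one_left:
  assumes "g \<in> lists A \<rightarrow> carrier R" "w \<in> lists A"
  shows "word_conv (\<lambda>u. if u = [] then \<one> else \<zero>) g w = g w"
  using assms by (cases w) (auto simp: Pi_iff word_conv_zero_left)

lemma word_conv_one_right:
  "f \<in> lists A \<rightarrow> carrier R \<Longrightarrow> w \<in> lists A \<Longrightarrow>
    word_conv f (\<lambda>u. if u = [] then \<one> else \<zero>) w = f w"
proof (induction w arbitrary: f)
  case (Cons x w)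
  have "word_conv (\<lambda>u. f (x # u)) (\<lambda>u. if u = [] then \<one> else \<zero>) w = f (x # w)"
    using Cons.prems by (intro Cons.IH Pi_lists_Cons) auto
  then show ?case using Cons.prems by (auto simp: Pi_iff)
qed (auto simp: Pi_iff)

section \<open>The monoid of series and its units with constant term 1\<close>

lemma nc_power_series_mult:
  assumes "f \<in> lists A \<rightarrow> carrier R" "g \<in> lists A \<rightarrow> carrier R"
  shows "f \<otimes>\<^bsub>nc_power_series R A\<^esub> g = restrict (word_conv f g) (lists A)"
  using finsum_eq_word_conv[OF assms(2,1)]
  by (simp add: nc_power_series_def cong: restrict_cong)

lemma nc_power_series_mult_Nil:
  assumes "f \<in> carrier (nc_power_series R A)" "g \<in> carrier (nc_power_series R A)"
  shows "(f \<otimes>\<^bsub>nc_power_series R A\<^esub> g) [] = f [] \<otimes> g []"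
  using assms by (subst nc_power_series_mult) (auto simp: nc_power_series_def)

lemma nc_power_series_one_Nil: "\<one>\<^bsub>nc_power_series R A\<^esub> [] = \<one>"
  by (simp add: nc_power_series_def)

lemma monoid_nc_power_series: "monoid (nc_power_series R A)"
proof -
  let ?S = "nc_power_series R A"
  have carr: "carrier ?S = lists A \<rightarrow>\<^sub>E carrier R" by (simp add: nc_power_series_def)
  have PiD: "f \<in> lists A \<rightarrow> carrier R" if "f \<in> carrier ?S" for f
    using that by (auto simp: carr)
  have restr: "restrict (word_conv f g) (lists A) \<in> lists A \<rightarrow> carrier R"
    if "f \<in> carrier ?S" "g \<in> carrier ?S" for f g
    using PiD[OF that(1)] PiD[OF that(2)] by (auto intro: word_conv_closed)
  have one: "\<one>\<^bsub>?S\<^esub> = (\<lambda>w\<in>lists A. if w = [] then \<one> else \<zero>)"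
    by (simp add: nc_power_series_def)
  have onePi: "\<one>\<^bsub>?S\<^esub> \<in> lists A \<rightarrow> carrier R" by (simp add: one)
  have restrict_self: "restrict f (lists A) = f" if "f \<in> carrier ?S" for f
    using that by (simp add: carr PiE_restrict)
  show ?thesis
  proof
    fix f g assume fg: "f \<in> carrier ?S" "g \<in> carrier ?S"
    show "f \<otimes>\<^bsub>?S\<^esub> g \<in> carrier ?S"
      unfolding nc_power_series_mult[OF PiD[OF fg(1)] PiD[OF fg(2)]] carr
      using restr[OF fg] by (simp add: PiE_def)
  next
    show "\<one>\<^bsub>?S\<^esub> \<in> carrier ?S" by (auto simp: carr one)
  next
    fix f g h assume fgh: "f \<in> carrier ?S" "g \<in> carrier ?S" "h \<in> carrier ?S"
    note P = PiD[OF fgh(1)] PiD[OF fgh(2)] PiD[OF fgh(3)]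
    have "f \<otimes>\<^bsub>?S\<^esub> g \<otimes>\<^bsub>?S\<^esub> h = restrict (word_conv (restrict (word_conv f g) (lists A)) h) (lists A)"
      using P restr[OF fgh(1,2)] by (simp add: nc_power_series_mult)
    also have "\<dots> = restrict (word_conv (word_conv f g) h) (lists A)"
      by (intro restrict_ext word_conv_cong[where A = A]) auto
    also have "\<dots> = restrict (word_conv f (word_conv g h)) (lists A)"
      by (intro restrict_ext word_conv_assoc[OF P(2,3,1)])
    also have "\<dots> = restrict (word_conv f (restrict (word_conv g h) (lists A))) (lists A)"
      by (intro restrict_ext word_conv_cong[where A = A]) auto
    also have "\<dots> = f \<otimes>\<^bsub>?S\<^esub> (g \<otimes>\<^bsub>?S\<^esub> h)"
      using P restr[OF fgh(2,3)] by (simp add: nc_power_series_mult)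
    finally show "f \<otimes>\<^bsub>?S\<^esub> g \<otimes>\<^bsub>?S\<^esub> h = f \<otimes>\<^bsub>?S\<^esub> (g \<otimes>\<^bsub>?S\<^esub> h)" .
  next
    fix f assume f: "f \<in> carrier ?S"
    have "\<one>\<^bsub>?S\<^esub> \<otimes>\<^bsub>?S\<^esub> f = restrict (word_conv \<one>\<^bsub>?S\<^esub> f) (lists A)"
      by (rule nc_power_series_mult[OF onePi PiD[OF f]])
    also have "\<dots> = restrict (word_conv (\<lambda>u. if u = [] then \<one> else \<zero>) f) (lists A)"
      by (intro restrict_ext word_conv_cong[where A = A]) (auto simp: one)
    also have "\<dots> = restrict f (lists A)"
      by (intro restrict_ext word_conv_one_left[OF PiD[OF f]])
    finally show "\<one>\<^bsub>?S\<^esub> \<otimes>\<^bsub>?S\<^esub> f = f" by (simp add: restrict_self f)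
    have "f \<otimes>\<^bsub>?S\<^esub> \<one>\<^bsub>?S\<^esub> = restrict (word_conv f \<one>\<^bsub>?S\<^esub>) (lists A)"
      by (rule nc_power_series_mult[OF PiD[OF f] onePi])
    also have "\<dots> = restrict (word_conv f (\<lambda>u. if u = [] then \<one> else \<zero>)) (lists A)"
      by (intro restrict_ext word_conv_cong[where A = A]) (auto simp: one)
    also have "\<dots> = restrict f (lists A)"
      by (intro restrict_ext word_conv_one_right[OF PiD[OF f]])
    finally show "f \<otimes>\<^bsub>?S\<^esub> \<one>\<^bsub>?S\<^esub> = f" by (simp add: restrict_self f)
  qed
qed

lemma group_units_nc_power_series: "group (units_of (nc_power_series R A))"
  by (rule monoid.units_group[OF monoid_nc_power_series])

text \<open>The empty word has only one factorization, so the constant term is multiplicative, and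
  these units form the kernel of the constant-term map.\<close>

lemma subgroup_constant_term_one:
  "subgroup {f \<in> Units (nc_power_series R A). f [] = \<one>} (units_of (nc_power_series R A))"
proof -
  let ?S = "nc_power_series R A"
  interpret S: monoid ?S by (rule monoid_nc_power_series)
  interpret U: group "units_of ?S" by (rule group_units_nc_power_series)
  show ?thesis
  proof (rule U.subgroupI)
    show "{f \<in> Units ?S. f [] = \<one>} \<noteq> {}"
      using S.Units_one_closed nc_power_series_one_Nil by blast
  next
    fix f assume f: "f \<in> {f \<in> Units ?S. f [] = \<one>}"
    then have inv: "inv\<^bsub>?S\<^esub> f \<in> Units ?S" by simp
    have "(inv\<^bsub>?S\<^esub> f) [] \<in> carrier R"
      using S.Units_closed[OF inv] by (auto simp: nc_power_series_def)
    moreover have "f [] \<otimes> (inv\<^bsub>?S\<^esub> f) [] = \<one>"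
      using f inv nc_power_series_mult_Nil[of f A "inv\<^bsub>?S\<^esub> f"]
      by (simp add: S.Units_closed nc_power_series_one_Nil)
    ultimately have "(inv\<^bsub>?S\<^esub> f) [] = \<one>" using f by simp
    then show "inv\<^bsub>units_of ?S\<^esub> f \<in> {f \<in> Units ?S. f [] = \<one>}"
      using f inv by (simp add: S.units_of_inv)
  qed (auto simp: units_of_carrier units_of_mult nc_power_series_mult_Nil S.Units_closed)
qed

end

section \<open>Passage to a subgroup of values, and the bijection for series\<close>

lemma dedekind_symbol_restrict_carrier:
  "H \<subseteq> carrier G \<Longrightarrow> dedekind_symbol (G\<lparr>carrier := H\<rparr>) D \<longleftrightarrow>
    dedekind_symbol G D \<and> (\<forall>x\<in>coprime_pairs. D x \<in> H)"
  unfolding dedekind_symbol_def PiE_iff by auto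

lemma reciprocity_function_restrict_carrier:
  "H \<subseteq> carrier G \<Longrightarrow> reciprocity_function (G\<lparr>carrier := H\<rparr>) F \<longleftrightarrow>
    reciprocity_function G F \<and> (\<forall>x\<in>coprime_pairs. F x \<in> H)"
  unfolding reciprocity_function_def PiE_iff by auto

text \<open>Only the inverse depends on the carrier, and inverses in a subgroup agree with those of
  the ambient group.\<close>

lemma (in group) associated_function_restrict_carrier:
  assumes "subgroup H G" "\<And>x. x \<in> coprime_pairs \<Longrightarrow> D x \<in> H"
  shows "associated_function (G\<lparr>carrier := H\<rparr>) D = associated_function G D"
  unfolding associated_function_def
  using assms(2) by (intro restrict_ext)
    (auto simp: coprime_pairs_iff coprime_commute m_inv_consistent[OF assms(1)])

theorem theorem3p5:
  fixes R :: "('r, 'm) ring_scheme" and A :: "'a set"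
  assumes "cring R"
  shows "bij_betw (associated_function (units_of (nc_power_series R A)))
           {D. multiple_dedekind_symbol R A D \<and> normalized R A D}
           {F. multiple_reciprocity_function R A F}"
proof -
  interpret R: cring R by (rule assms)
  define U where "U = units_of (nc_power_series R A)"
  define H where "H = {f \<in> Units (nc_power_series R A). f [] = \<one>\<^bsub>R\<^esub>}"
  interpret U: group U unfolding U_def by (rule R.group_units_nc_power_series)
  have H: "subgroup H U"
    unfolding H_def U_def by (rule R.subgroup_constant_term_one)
  \<comment> \<open>Taking \<open>H\<close> as the group of values builds the constant-term
    condition into the target, so that the symbol constructed from a multiple reciprocity function
    is again of the required form.\<close>
  interpret K: group "U\<lparr>carrier := H\<rparr>" by (rule U.subgroup_imp_group[OF H])
  have HU: "H \<subseteq> carrier U" by (rule subgroup.subset[OF H])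
  have carrier_U: "carrier U = Units (nc_power_series R A)"
    by (simp add: U_def units_of_carrier)
  have dedekind: "multiple_dedekind_symbol R A D \<longleftrightarrow> dedekind_symbol (U\<lparr>carrier := H\<rparr>) D" for D
    unfolding multiple_dedekind_symbol_def dedekind_symbol_restrict_carrier[OF HU] U_def[symmetric]
    by (auto simp: H_def dedekind_symbol_def PiE_iff carrier_U)
  have reciprocity:
    "multiple_reciprocity_function R A F \<longleftrightarrow> reciprocity_function (U\<lparr>carrier := H\<rparr>) F" for F
    unfolding multiple_reciprocity_function_def reciprocity_function_restrict_carrier[OF HU]
      U_def[symmetric]
    by (auto simp: H_def reciprocity_function_def PiE_iff carrier_U)
  have norm: "normalized R A D \<longleftrightarrow> D (1, 1) = \<one>\<^bsub>U\<lparr>carrier := H\<rparr>\<^esub>" for D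
    by (simp add: normalized_def U_def units_of_one)
  have "bij_betw (associated_function (U\<lparr>carrier := H\<rparr>))
      {D. multiple_dedekind_symbol R A D \<and> normalized R A D}
      {F. multiple_reciprocity_function R A F}"
    using K.bij_betw_associated_function by (simp add: dedekind reciprocity norm)
  \<comment> \<open>Agreement is available for symbols with values in \<open>H\<close>, so the two
    maps are exchanged by congruence on the domain of the bijection.\<close>
  moreover have "associated_function (U\<lparr>carrier := H\<rparr>) D = associated_function U D"
    if "multiple_dedekind_symbol R A D" for D
    using that U.associated_function_restrict_carrier[OF H]
    by (simp add: dedekind dedekind_symbol_restrict_carrier[OF HU])
  ultimately show ?thesis
    unfolding U_def[symmetric] by (subst bij_betw_cong[symmetric]) auto
qed

end
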